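(* For every program $P$ of $\mathcal{L}(\mathcal{S})$ and every variable $a$ of $P$ there is a Past LTL formula $\varphi$ over the input variables of $P$, of size at most exponential in the size of $P$, such that for every interpretation $I$ and time point $t$, $(P,I,t)\models a$ iff $(P,I,t)\models\varphi$.
   Context: Past LTL: formulas are built from propositional variables and $\top,\bot$ using $\neg,\land,\lor$, the before operator $\ominus$ and the since operator $\mathsf{S}$; $(I,t)\models\ominus\alpha$ iff $(I,t-1)\models\alpha$; $(I,t)\models\alpha\,\mathsf{S}\,\beta$ iff there is $j\in[1,t]$ with $(I,j)\models\beta$ and $(I,k)\models\alpha$ for all $k\in[j+1,t]$; Boolean connectives and variables as usual. Programs: write $\mathbb{B}=\{0,1\}$. An operator automaton is $\mathcal{A}=\langle \mathbb{B}^m,[1,n],\delta,q_{\mathrm{init}}\rangle$ with $\delta:[1,n]\times\mathbb{B}^m\to[1,n]$. Rules: static $p \;{:}{-}\; \alpha$ ($\alpha$ built from variables, $\top,\bot$ with $\neg,\land,\lor$); delay $p \;{:}{-}\; \ominus q$; dynamic $p_1,\dots,p_n \;{:}{-}\; \mathcal{A}(a_1,\dots,a_m)$. A program is a finite set of rules that is nonrecursive (the graph with an edge $a\to b$ whenever $a$ occurs in the body and $b$ in the head of a rule is acyclic) and definitorial (each variable is in at most one head). Non-defined variables are input variables; an interpretation is a finite non-empty sequence $I=I_1,\dots,I_\ell$ of subsets of input variables. Satisfaction $(P,I,t)\models\cdot$ extends the Past LTL semantics: input $a$ holds iff $a\in I_t$; $p$ defined by $p\;{:}{-}\;\alpha$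 iff $(P,I,t)\models\alpha$; $p$ defined by $p\;{:}{-}\;\ominus q$ iff $(P,I,t-1)\models q$; for $p_i$ defined by a dynamic rule, $(P,I,0)\models p_i$ iff $q_{\mathrm{init}}=i$, and for $t>0$, $(P,I,t)\models p_i$ iff there are $j$ and $\sigma\in\mathbb{B}^m$ (an assignment to $a_1,\dots,a_m$, identified with the conjunction of literals it makes true) with $\delta(j,\sigma)=i$, $(P,I,t-1)\models p_j$, $(P,I,t)\models\sigma$. $\mathcal{L}(\mathcal{S})$ is the set of programs whose dynamic rules all use the operator $\mathcal{S}=\langle\mathbb{B}^2,\{1,2\},\delta,1\rangle$ with $\delta(q,10)=q$, $\delta(q,01)=\delta(q,11)=2$, $\delta(q,00)=1$. *)

theory Defs
  imports Main
begin

section \<open>Past LTL\<close>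

datatype (ltl_vars: 'v) ltl =
    Top
  | Bot
  | Var 'v
  | Neg "'v ltl"
  | And "'v ltl" "'v ltl"
  | Or "'v ltl" "'v ltl"
  | Before "'v ltl"
  | Since "'v ltl" "'v ltl"

text \<open>Number of symbol occurrences; unlike the generated \<^const>\<open>size\<close>, leaves count 1.\<close>
primrec ltl_size :: "'v ltl \<Rightarrow> nat" where
  "ltl_size Top = 1"
| "ltl_size Bot = 1"
| "ltl_size (Var a) = 1"
| "ltl_size (Neg \<phi>) = 1 + ltl_size \<phi>"
| "ltl_size (And \<phi> \<psi>) = 1 + ltl_size \<phi> + ltl_size \<psi>"
| "ltl_size (Or \<phi> \<psi>) = 1 + ltl_size \<phi> + ltl_size \<psi>"
| "ltl_size (Before \<phi>) = 1 + ltl_size \<phi>"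
| "ltl_size (Since \<phi> \<psi>) = 1 + ltl_size \<phi> + ltl_size \<psi>"

primrec propositional :: "'v ltl \<Rightarrow> bool" where
  "propositional Top \<longleftrightarrow> True"
| "propositional Bot \<longleftrightarrow> True"
| "propositional (Var a) \<longleftrightarrow> True"
| "propositional (Neg \<phi>) \<longleftrightarrow> propositional \<phi>"
| "propositional (And \<phi> \<psi>) \<longleftrightarrow> propositional \<phi> \<and> propositional \<psi>"
| "propositional (Or \<phi> \<psi>) \<longleftrightarrow> propositional \<phi> \<and> propositional \<psi>"
| "propositional (Before \<phi>) \<longleftrightarrow> False"
| "propositional (Since \<phi> \<psi>) \<longleftrightarrow> False"

text \<open>
  A formula is evaluated over a valuation \<open>V\<close>, where \<open>V t a\<close> is the truth value of the
  variable \<open>a\<close> at time \<open>t\<close>.  The time points of an interpretation of length \<open>l\<close> are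
  \<open>1, ..., l\<close>, but the clause for \<^const>\<open>Before\<close> steps unconditionally from \<open>t\<close> to \<open>t - 1\<close>, so
  evaluation at time 1 can reach time 0 and, through nested occurrences, negative times.
  Times are therefore integers; truncated subtraction on \<^typ>\<open>nat\<close> would identify
  the predecessor of 0 with 0.
\<close>
primrec holds :: "(int \<Rightarrow> 'v \<Rightarrow> bool) \<Rightarrow> int \<Rightarrow> 'v ltl \<Rightarrow> bool" where
  "holds V t Top \<longleftrightarrow> True"
| "holds V t Bot \<longleftrightarrow> False"
| "holds V t (Var a) \<longleftrightarrow> V t a"
| "holds V t (Neg \<phi>) \<longleftrightarrow> \<not> holds V t \<phi>"
| "holds V t (And \<phi> \<psi>) \<longleftrightarrow> holds V t \<phi> \<and> holds V t \<psi>"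
| "holds V t (Or \<phi> \<psi>) \<longleftrightarrow> holds V t \<phi> \<or> holds V t \<psi>"
| "holds V t (Before \<phi>) \<longleftrightarrow> holds V (t - 1) \<phi>"
| "holds V t (Since \<phi> \<psi>) \<longleftrightarrow>
     (\<exists>j\<in>{1..t}. holds V j \<psi> \<and> (\<forall>k\<in>{j + 1..t}. holds V k \<phi>))"


section \<open>Programs\<close>

text \<open>
  \<open>Automaton m n d q\<close> has input alphabet the bit lists of length \<open>m\<close>, states \<open>1, ..., n\<close>,
  transition function \<open>d\<close> and initial state \<open>q\<close>.  Values of \<open>d\<close> outside this
  domain are irrelevant.
\<close>
datatype automaton =
  Automaton (arity: nat) (states: nat) (delta: "nat \<Rightarrow> bool list \<Rightarrow> nat") (q_init: nat)

definition automaton_wf :: "automaton \<Rightarrow> bool" where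
  "automaton_wf A \<longleftrightarrow> q_init A \<in> {1..states A} \<and>
     (\<forall>q\<in>{1..states A}. \<forall>\<sigma>. length \<sigma> = arity A \<longrightarrow> delta A q \<sigma> \<in> {1..states A})"

datatype 'v rule =
    Static 'v "'v ltl"
  | Delay 'v 'v
  | Dynamic "'v list" automaton "'v list"

primrec head_vars :: "'v rule \<Rightarrow> 'v set" where
  "head_vars (Static p \<alpha>) = {p}"
| "head_vars (Delay p q) = {p}"
| "head_vars (Dynamic ps A as) = set ps"

primrec body_vars :: "'v rule \<Rightarrow> 'v set" where
  "body_vars (Static p \<alpha>) = ltl_vars \<alpha>"
| "body_vars (Delay p q) = {q}"
| "body_vars (Dynamic ps A as) = set as"

primrec rule_wf :: "'v rule \<Rightarrow> bool" where
  "rule_wf (Static p \<alpha>) \<longleftrightarrow> propositional \<alpha>"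
| "rule_wf (Delay p q) \<longleftrightarrow> True"
| "rule_wf (Dynamic ps A as) \<longleftrightarrow> automaton_wf A \<and> length ps = states A \<and> distinct ps \<and>
     length as = arity A"

definition dependency :: "'v rule set \<Rightarrow> ('v \<times> 'v) set" where
  "dependency P = {(a, b). \<exists>r\<in>P. a \<in> body_vars r \<and> b \<in> head_vars r}"

definition nonrecursive :: "'v rule set \<Rightarrow> bool" where
  "nonrecursive P \<longleftrightarrow> acyclic (dependency P)"

text \<open>
  Repetition of a variable within a single head is excluded by \<^const>\<open>rule_wf\<close>.
\<close>
definition definitorial :: "'v rule set \<Rightarrow> bool" where
  "definitorial P \<longleftrightarrow> (\<forall>r\<in>P. \<forall>r'\<in>P. r \<noteq> r' \<longrightarrow> head_vars r \<inter> head_vars r' = {})"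

definition program :: "'v rule set \<Rightarrow> bool" where
  "program P \<longleftrightarrow> finite P \<and> (\<forall>r\<in>P. rule_wf r) \<and> nonrecursive P \<and> definitorial P"

definition program_vars :: "'v rule set \<Rightarrow> 'v set" where
  "program_vars P = (\<Union>r\<in>P. head_vars r \<union> body_vars r)"

definition defined_vars :: "'v rule set \<Rightarrow> 'v set" where
  "defined_vars P = (\<Union>r\<in>P. head_vars r)"

definition input_vars :: "'v rule set \<Rightarrow> 'v set" where
  "input_vars P = program_vars P - defined_vars P"

text \<open>Number of symbol occurrences, an automaton counting as a single operator symbol.\<close>
primrec rule_size :: "'v rule \<Rightarrow> nat" where
  "rule_size (Static p \<alpha>) = 1 + ltl_size \<alpha>"
| "rule_size (Delay p q) = 3"
| "rule_size (Dynamic ps A as) = length ps + 1 + length as"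

definition program_size :: "'v rule set \<Rightarrow> nat" where
  "program_size P = (\<Sum>r\<in>P. rule_size r)"

definition interpretation_of :: "'v rule set \<Rightarrow> 'v set list \<Rightarrow> bool" where
  "interpretation_of P I \<longleftrightarrow> I \<noteq> [] \<and> (\<forall>X\<in>set I. X \<subseteq> input_vars P)"


section \<open>Semantics of programs\<close>

text \<open>The statement \<open>a \<in> I\<^sub>t\<close>, false if there is no \<open>I\<^sub>t\<close>.  Lists are indexed from 0.\<close>
definition in_interp :: "'v set list \<Rightarrow> int \<Rightarrow> 'v \<Rightarrow> bool" where
  "in_interp I t a \<longleftrightarrow> t \<in> {1..int (length I)} \<and> a \<in> I ! nat (t - 1)"

text \<open>
  The satisfaction clauses for variables.  At a negative time neither alternative of the
  clause for dynamic rules applies, so there the variable is false, just as an input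
  variable is false where the interpretation has no element.
\<close>
definition is_valuation ::
    "'v rule set \<Rightarrow> 'v set list \<Rightarrow> (int \<Rightarrow> 'v \<Rightarrow> bool) \<Rightarrow> bool" where
  "is_valuation P I V \<longleftrightarrow>
     (\<forall>t a. a \<notin> defined_vars P \<longrightarrow> (V t a \<longleftrightarrow> in_interp I t a)) \<and>
     (\<forall>t p \<alpha>. Static p \<alpha> \<in> P \<longrightarrow> (V t p \<longleftrightarrow> holds V t \<alpha>)) \<and>
     (\<forall>t p q. Delay p q \<in> P \<longrightarrow> (V t p \<longleftrightarrow> holds V t (Before (Var q)))) \<and>
     (\<forall>t ps A as i. Dynamic ps A as \<in> P \<and> i \<in> {1..states A} \<longrightarrow>
        (V t (ps ! (i - 1)) \<longleftrightarrow>
           t = 0 \<and> q_init A = i \<or>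
           t > 0 \<and> (\<exists>j\<in>{1..states A}. \<exists>\<sigma>. length \<sigma> = arity A \<and> delta A j \<sigma> = i \<and>
             V (t - 1) (ps ! (j - 1)) \<and> (\<forall>k<arity A. V t (as ! k) \<longleftrightarrow> \<sigma> ! k))))"

text \<open>
  \<open>sat P I t \<phi>\<close> is $(P,I,t)\models\varphi$.  For every program the valuation exists and is
  unique: lemma \<open>ex1_valuation\<close> below.
\<close>
definition sat :: "'v rule set \<Rightarrow> 'v set list \<Rightarrow> int \<Rightarrow> 'v ltl \<Rightarrow> bool" where
  "sat P I t \<phi> \<longleftrightarrow> holds (THE V. is_valuation P I V) t \<phi>"


section \<open>The since operator as an automaton\<close>

definition delta_S :: "nat \<Rightarrow> bool list \<Rightarrow> nat" where
  "delta_S q \<sigma> =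
     (if \<sigma> = [True, False] then q
      else if \<sigma> = [False, True] \<or> \<sigma> = [True, True] then 2
      else 1)"

definition op_S :: automaton where
  "op_S = Automaton 2 2 delta_S 1"

definition lang_S :: "'v rule set set" where
  "lang_S = {P. program P \<and> (\<forall>ps A as. Dynamic ps A as \<in> P \<longrightarrow> A = op_S)}"


section \<open>Well-definedness of satisfaction\<close>

lemma automaton_wf_op_S: "automaton_wf op_S"
  by (auto simp: automaton_wf_def op_S_def delta_S_def)

lemma holds_propositional_cong:
  assumes "propositional \<alpha>" "\<And>a. a \<in> ltl_vars \<alpha> \<Longrightarrow> V t a = W t a"
  shows "holds V t \<alpha> = holds W t \<alpha>"
  using assms by (induction \<alpha>) auto

definition step_valuation ::
    "'v rule set \<Rightarrow> 'v set list \<Rightarrow> (int \<Rightarrow> 'v \<Rightarrow> bool) \<Rightarrow> int \<Rightarrow> 'v \<Rightarrow> bool" where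
  "step_valuation P I V t a \<longleftrightarrow>
     a \<notin> defined_vars P \<and> in_interp I t a \<or>
     (\<exists>\<alpha>. Static a \<alpha> \<in> P \<and> holds V t \<alpha>) \<or>
     (\<exists>q. Delay a q \<in> P \<and> V (t - 1) q) \<or>
     (\<exists>ps A as i. Dynamic ps A as \<in> P \<and> i \<in> {1..states A} \<and> a = ps ! (i - 1) \<and>
        (t = 0 \<and> q_init A = i \<or>
         t > 0 \<and> (\<exists>j\<in>{1..states A}. \<exists>\<sigma>. length \<sigma> = arity A \<and> delta A j \<sigma> = i \<and>
           V (t - 1) (ps ! (j - 1)) \<and> (\<forall>k<arity A. V t (as ! k) \<longleftrightarrow> \<sigma> ! k))))"

lemma program_rule_unique:
  assumes "program P" "r \<in> P" "r' \<in> P" "a \<in> head_vars r" "a \<in> head_vars r'"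
  shows "r = r'"
  using assms unfolding program_def definitorial_def by blast

lemma program_Dynamic:
  assumes "program P" "Dynamic ps A as \<in> P"
  shows "automaton_wf A" "length ps = states A" "distinct ps" "length as = arity A"
  using assms unfolding program_def by fastforce+

lemma head_Dynamic:
  assumes "program P" "Dynamic ps A as \<in> P" "i \<in> {1..states A}"
  shows "ps ! (i - 1) \<in> set ps"
  using program_Dynamic[OF assms(1,2)] assms(3) by auto

lemma is_valuation_iff_step:
  assumes "program P"
  shows "is_valuation P I V \<longleftrightarrow> (\<forall>t a. V t a \<longleftrightarrow> step_valuation P I V t a)"
proof -
  note uniq = program_rule_unique[OF assms]
  have 1: "step_valuation P I V t a \<longleftrightarrow> in_interp I t a" if "a \<notin> defined_vars P" for t a
    using that head_Dynamic[OF assms] unfolding step_valuation_def defined_vars_def by fastforce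
  have 2: "step_valuation P I V t p \<longleftrightarrow> holds V t \<alpha>" if r: "Static p \<alpha> \<in> P" for t p \<alpha>
  proof -
    have d: "p \<in> defined_vars P"
      using r unfolding defined_vars_def by force
    have u: "r' = Static p \<alpha>" if "r' \<in> P" "p \<in> head_vars r'" for r'
      using uniq[OF that(1) r that(2)] by simp
    have "\<beta> = \<alpha>" if "Static p \<beta> \<in> P" for \<beta> using u[OF that] by simp
    moreover have "Delay p q \<notin> P" for q using u[of "Delay p q"] by auto
    moreover have "p \<noteq> ps ! (i - 1)" if "Dynamic ps A as \<in> P" "i \<in> {1..states A}" for ps A as i
      using u[OF that(1)] head_Dynamic[OF assms that] by auto
    ultimately show ?thesis
      using r d unfolding step_valuation_def by blast
  qed
  have 3: "step_valuation P I V t p \<longleftrightarrow> V (t - 1) q" if r: "Delay p q \<in> P" for t p q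
  proof -
    have d: "p \<in> defined_vars P"
      using r unfolding defined_vars_def by force
    have u: "r' = Delay p q" if "r' \<in> P" "p \<in> head_vars r'" for r'
      using uniq[OF that(1) r that(2)] by simp
    have "q' = q" if "Delay p q' \<in> P" for q' using u[OF that] by simp
    moreover have "Static p \<alpha> \<notin> P" for \<alpha> using u[of "Static p \<alpha>"] by auto
    moreover have "p \<noteq> ps ! (i - 1)" if "Dynamic ps A as \<in> P" "i \<in> {1..states A}" for ps A as i
      using u[OF that(1)] head_Dynamic[OF assms that] by auto
    ultimately show ?thesis
      using r d unfolding step_valuation_def by blast
  qed
  have 4: "step_valuation P I V t (ps ! (i - 1)) \<longleftrightarrow>
           t = 0 \<and> q_init A = i \<or>
           t > 0 \<and> (\<exists>j\<in>{1..states A}. \<exists>\<sigma>. length \<sigma> = arity A \<and> delta A j \<sigma> = i \<and>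
             V (t - 1) (ps ! (j - 1)) \<and> (\<forall>k<arity A. V t (as ! k) \<longleftrightarrow> \<sigma> ! k))"
    (is "_ \<longleftrightarrow> ?R") if r: "Dynamic ps A as \<in> P" and i: "i \<in> {1..states A}" for t ps A as i
  proof -
    let ?p = "ps ! (i - 1)"
    have p: "?p \<in> set ps" using head_Dynamic[OF assms r i] .
    have d: "?p \<in> defined_vars P"
      using r p unfolding defined_vars_def by force
    have u: "r' = Dynamic ps A as" if "r' \<in> P" "?p \<in> head_vars r'" for r'
      using uniq[OF that(1) r that(2)] p by simp
    have s: "Static ?p \<alpha> \<notin> P" for \<alpha> using u[of "Static ?p \<alpha>"] by auto
    have l: "Delay ?p q \<notin> P" for q using u[of "Delay ?p q"] by auto
    have y: "ps' = ps \<and> A' = A \<and> as' = as \<and> i' = i"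
      if "Dynamic ps' A' as' \<in> P" "i' \<in> {1..states A'}" "?p = ps' ! (i' - 1)" for ps' A' as' i'
    proof -
      have "ps' = ps \<and> A' = A \<and> as' = as"
        using u[OF that(1)] head_Dynamic[OF assms that(1,2)] that(3) by simp
      moreover from this have "i - 1 = i' - 1"
        using program_Dynamic[OF assms r] i that(2,3)
          nth_eq_iff_index_eq[of ps "i - 1" "i' - 1"] by fastforce
      ultimately show ?thesis using i that(2) by auto
    qed
    show ?thesis
    proof
      assume ?R
      then show "step_valuation P I V t ?p"
        using r i unfolding step_valuation_def by blast
    next
      assume "step_valuation P I V t ?p"
      then obtain ps' A' as' i' where *: "Dynamic ps' A' as' \<in> P" "i' \<in> {1..states A'}"
        "?p = ps' ! (i' - 1)"
        and **: "t = 0 \<and> q_init A' = i' \<or>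
           t > 0 \<and> (\<exists>j\<in>{1..states A'}. \<exists>\<sigma>. length \<sigma> = arity A' \<and> delta A' j \<sigma> = i' \<and>
             V (t - 1) (ps' ! (j - 1)) \<and> (\<forall>k<arity A'. V t (as' ! k) \<longleftrightarrow> \<sigma> ! k))"
        using d s l unfolding step_valuation_def by blast
      show ?R using ** y[OF *] by simp
    qed
  qed
  have 5: "a \<notin> defined_vars P \<or> (\<exists>\<alpha>. Static a \<alpha> \<in> P) \<or> (\<exists>q. Delay a q \<in> P) \<or>
      (\<exists>ps A as i. Dynamic ps A as \<in> P \<and> i \<in> {1..states A} \<and> a = ps ! (i - 1))" for a
  proof (cases "a \<in> defined_vars P")
    case True
    then obtain r where r: "r \<in> P" "a \<in> head_vars r" unfolding defined_vars_def by blast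
    show ?thesis
    proof (cases r)
      case (Dynamic ps A as)
      then obtain k where "k < length ps" "a = ps ! k"
        using r by (auto simp: in_set_conv_nth)
      then have "Suc k \<in> {1..states A}" "a = ps ! (Suc k - 1)"
        using program_Dynamic[OF assms] r Dynamic by auto
      then show ?thesis using r Dynamic by blast
    qed (use r in auto)
  qed simp
  show ?thesis
  proof
    assume v: "is_valuation P I V"
    show "\<forall>t a. V t a \<longleftrightarrow> step_valuation P I V t a"
    proof (intro allI)
      fix t a
      show "V t a \<longleftrightarrow> step_valuation P I V t a"
        using 5[of a]
      proof (elim disjE exE conjE)
        assume "a \<notin> defined_vars P"
        then show ?thesis using v 1 unfolding is_valuation_def by simp
      next
        fix \<alpha> assume "Static a \<alpha> \<in> P"
        then show ?thesis using v 2 unfolding is_valuation_def by simp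
      next
        fix q assume "Delay a q \<in> P"
        then show ?thesis using v 3 unfolding is_valuation_def by simp
      next
        fix ps A as i assume *: "Dynamic ps A as \<in> P" "i \<in> {1..states A}" "a = ps ! (i - 1)"
        have "V t (ps ! (i - 1)) \<longleftrightarrow>
           t = 0 \<and> q_init A = i \<or>
           t > 0 \<and> (\<exists>j\<in>{1..states A}. \<exists>\<sigma>. length \<sigma> = arity A \<and> delta A j \<sigma> = i \<and>
             V (t - 1) (ps ! (j - 1)) \<and> (\<forall>k<arity A. V t (as ! k) \<longleftrightarrow> \<sigma> ! k))"
          by (rule v[unfolded is_valuation_def, THEN conjunct2, THEN conjunct2, THEN conjunct2,
            rule_format, OF conjI[OF *(1,2)]])
        then show ?thesis unfolding \<open>a = ps ! (i - 1)\<close> 4[OF *(1,2)] .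
      qed
    qed
  next
    assume v: "\<forall>t a. V t a \<longleftrightarrow> step_valuation P I V t a"
    show "is_valuation P I V"
      unfolding is_valuation_def
    proof (intro conjI allI impI)
      fix t a assume "a \<notin> defined_vars P"
      then show "V t a \<longleftrightarrow> in_interp I t a" using v 1 by blast
    next
      fix t p \<alpha> assume "Static p \<alpha> \<in> P"
      then show "V t p \<longleftrightarrow> holds V t \<alpha>" using v 2 by blast
    next
      fix t p q assume "Delay p q \<in> P"
      then show "V t p \<longleftrightarrow> holds V t (Before (Var q))" using v 3 by simp
    next
      fix t ps A as i assume *: "Dynamic ps A as \<in> P \<and> i \<in> {1..states A}"
      show "V t (ps ! (i - 1)) \<longleftrightarrow>
           t = 0 \<and> q_init A = i \<or>
           t > 0 \<and> (\<exists>j\<in>{1..states A}. \<exists>\<sigma>. length \<sigma> = arity A \<and> delta A j \<sigma> = i \<and>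
             V (t - 1) (ps ! (j - 1)) \<and> (\<forall>k<arity A. V t (as ! k) \<longleftrightarrow> \<sigma> ! k))"
        using v 4[OF conjunct1[OF *] conjunct2[OF *], of t] by simp
    qed
  qed
qed

definition var_rank :: "'v rule set \<Rightarrow> 'v \<Rightarrow> nat" where
  "var_rank P a = card {b. (b, a) \<in> (dependency P)\<^sup>+}"

lemma finite_dependency:
  fixes P :: "'v rule set"
  assumes "finite P" shows "finite (dependency P)"
proof -
  have fin: "finite (head_vars r)" "finite (body_vars r)" for r :: "'v rule"
  proof -
    have "finite (ltl_vars \<alpha>)" for \<alpha> :: "'v ltl" by (induction \<alpha>) auto
    then show "finite (head_vars r)" "finite (body_vars r)" by (cases r; simp)+
  qed
  have "dependency P = (\<Union>r\<in>P. body_vars r \<times> head_vars r)"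
    unfolding dependency_def by blast
  then show ?thesis using assms fin by simp
qed

lemma var_rank_less:
  assumes "program P" "r \<in> P" "a \<in> body_vars r" "b \<in> head_vars r"
  shows "var_rank P a < var_rank P b"
proof -
  let ?D = "dependency P"
  have ab: "(a, b) \<in> ?D" using assms unfolding dependency_def by blast
  have "finite (?D\<^sup>+)" using finite_dependency[of P] assms(1) by (simp add: program_def)
  then have "finite {c. (c, b) \<in> ?D\<^sup>+}"
    by (rule finite_subset[rotated, OF finite_imageI[of _ fst]]) force
  moreover have "{c. (c, a) \<in> ?D\<^sup>+} \<subset> {c. (c, b) \<in> ?D\<^sup>+}"
    using ab assms(1) unfolding program_def nonrecursive_def acyclic_def
    by (auto intro: trancl_into_trancl)
  ultimately show ?thesis unfolding var_rank_def by (rule psubset_card_mono)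
qed

lemma var_rank_same_head:
  assumes "program P" "r \<in> P" "a \<in> head_vars r" "b \<in> head_vars r"
  shows "var_rank P a = var_rank P b"
proof -
  let ?D = "dependency P"
  have "(c, a) \<in> ?D \<longleftrightarrow> (c, b) \<in> ?D" for c
    using assms program_rule_unique[OF assms(1)] unfolding dependency_def by blast
  then have "(c, a) \<in> ?D\<^sup>+ \<longleftrightarrow> (c, b) \<in> ?D\<^sup>+" for c
    unfolding trancl_unfold_right by blast
  then show ?thesis unfolding var_rank_def by simp
qed

definition eval_order :: "'v rule set \<Rightarrow> ((int \<times> 'v) \<times> (int \<times> 'v)) set" where
  "eval_order P = measures [\<lambda>x. var_rank P (snd x), \<lambda>x. nat (fst x)]"

lemma wf_eval_order: "wf (eval_order P)"
  unfolding eval_order_def by simp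

lemma step_valuation_cong:
  assumes P: "program P"
    and eq: "\<And>s b. ((s, b), (t, a)) \<in> eval_order P \<Longrightarrow> V s b = W s b"
  shows "step_valuation P I V t a \<longleftrightarrow> step_valuation P I W t a"
proof -
  have body: "V s b = W s b" if "r \<in> P" "b \<in> body_vars r" "a \<in> head_vars r" for r s b
    using var_rank_less[OF P that] by (intro eq) (simp add: eval_order_def)
  have s: "holds V t \<alpha> = holds W t \<alpha>" if "Static a \<alpha> \<in> P" for \<alpha>
  proof (rule holds_propositional_cong)
    show "propositional \<alpha>" using that P unfolding program_def by fastforce
  qed (use body[OF that] in simp)
  have l: "V (t - 1) q = W (t - 1) q" if "Delay a q \<in> P" for q
    using body[OF that] by simp
  have d: "(\<exists>\<sigma>. length \<sigma> = arity A \<and> delta A j \<sigma> = i \<and>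
           V (t - 1) (ps ! (j - 1)) \<and> (\<forall>k<arity A. V t (as ! k) \<longleftrightarrow> \<sigma> ! k)) \<longleftrightarrow>
       (\<exists>\<sigma>. length \<sigma> = arity A \<and> delta A j \<sigma> = i \<and>
           W (t - 1) (ps ! (j - 1)) \<and> (\<forall>k<arity A. W t (as ! k) \<longleftrightarrow> \<sigma> ! k))"
    if r: "Dynamic ps A as \<in> P" and i: "i \<in> {1..states A}" "a = ps ! (i - 1)" "t > 0"
      and j: "j \<in> {1..states A}" for ps A as i j
  proof -
    have a: "a \<in> set ps" using head_Dynamic[OF P r i(1)] i(2) by simp
    have "var_rank P (ps ! (j - 1)) = var_rank P a"
      by (rule var_rank_same_head[OF P r]) (use head_Dynamic[OF P r j] a in auto)
    then have "V (t - 1) (ps ! (j - 1)) = W (t - 1) (ps ! (j - 1))"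
      using \<open>t > 0\<close> by (intro eq) (simp add: eval_order_def)
    moreover have "V t (as ! k) = W t (as ! k)" if "k < arity A" for k
      using body[OF r] a that program_Dynamic[OF P r] by simp
    ultimately show ?thesis by simp
  qed
  have "(\<exists>\<alpha>. Static a \<alpha> \<in> P \<and> holds V t \<alpha>) \<longleftrightarrow> (\<exists>\<alpha>. Static a \<alpha> \<in> P \<and> holds W t \<alpha>)"
    using s by blast
  moreover have "(\<exists>q. Delay a q \<in> P \<and> V (t - 1) q) \<longleftrightarrow> (\<exists>q. Delay a q \<in> P \<and> W (t - 1) q)"
    using l by blast
  moreover have "(\<exists>ps A as i. Dynamic ps A as \<in> P \<and> i \<in> {1..states A} \<and> a = ps ! (i - 1) \<and>
        (t = 0 \<and> q_init A = i \<or>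
         t > 0 \<and> (\<exists>j\<in>{1..states A}. \<exists>\<sigma>. length \<sigma> = arity A \<and> delta A j \<sigma> = i \<and>
           V (t - 1) (ps ! (j - 1)) \<and> (\<forall>k<arity A. V t (as ! k) \<longleftrightarrow> \<sigma> ! k)))) \<longleftrightarrow>
     (\<exists>ps A as i. Dynamic ps A as \<in> P \<and> i \<in> {1..states A} \<and> a = ps ! (i - 1) \<and>
        (t = 0 \<and> q_init A = i \<or>
         t > 0 \<and> (\<exists>j\<in>{1..states A}. \<exists>\<sigma>. length \<sigma> = arity A \<and> delta A j \<sigma> = i \<and>
           W (t - 1) (ps ! (j - 1)) \<and> (\<forall>k<arity A. W t (as ! k) \<longleftrightarrow> \<sigma> ! k))))"
    by ((rule ex_cong1)+, (rule conj_cong[OF refl])+, rule arg_cong2[where f = "(\<or>)", OF refl],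
      rule conj_cong[OF refl], rule bex_cong[OF refl], rule d)
  ultimately show ?thesis
    unfolding step_valuation_def by (simp only:)
qed

lemma ex1_valuation:
  assumes P: "program P"
  shows "\<exists>!V. is_valuation P I V"
proof (rule ex_ex1I)
  define F where "F f x = step_valuation P I (curry f) (fst x) (snd x)" for f x
  have "adm_wf (eval_order P) F"
    unfolding adm_wf_def F_def
    by (intro allI impI step_valuation_cong[OF P]) auto
  then have fix_F: "wfrec (eval_order P) F = F (wfrec (eval_order P) F)"
    by (rule wfrec_fixpoint[OF wf_eval_order])
  have "curry (wfrec (eval_order P) F) t a
      \<longleftrightarrow> step_valuation P I (curry (wfrec (eval_order P) F)) t a" for t a
    using fun_cong[OF fix_F, of "(t, a)"] unfolding F_def by simp
  then show "\<exists>V. is_valuation P I V"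
    using is_valuation_iff_step[OF P] by blast
next
  fix V W assume "is_valuation P I V" "is_valuation P I W"
  then have V: "V t a \<longleftrightarrow> step_valuation P I V t a" and W: "W t a \<longleftrightarrow> step_valuation P I W t a"
    for t a using is_valuation_iff_step[OF P] by blast+
  have "V (fst x) (snd x) = W (fst x) (snd x)" for x
    using wf_eval_order[of P]
  proof (induction x rule: wf_induct_rule)
    case (less x)
    have "step_valuation P I V (fst x) (snd x) = step_valuation P I W (fst x) (snd x)"
      using less by (intro step_valuation_cong[OF P]) force
    then show ?case using V W by blast
  qed
  from this[of "(t, a)" for t a] show "V = W" by (intro ext) simp
qed

lemma is_valuation_the:
  assumes "program P"
  shows "is_valuation P I (THE V. is_valuation P I V)"
  using theI'[OF ex1_valuation[OF assms]] .

end

theory Submission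
  imports Defs
begin

text \<open>
  The rules are unfolded along the dependency order: static rules by substitution, the two heads of
  a dynamic rule as \<open>\<phi> S \<psi>\<close> and its negation.  This is correct at positive times only: at times
  below 1 a Past LTL formula has the same value everywhere, whereas the first head of a dynamic rule
  is true at 0 and false before.  Delay rules, which can look back to time 0, are nevertheless
  expressible since the value of a variable at time 0 does not depend on the interpretation, so the
  formula can have it built in for time 1.  A rule multiplies the size of formulas by at most 2 to
  the power of its own size.
\<close>

section \<open>Substitution into formulas\<close>

primrec subst :: "('v \<Rightarrow> 'w ltl) \<Rightarrow> 'v ltl \<Rightarrow> 'w ltl" where
  "subst f Top = Top"
| "subst f Bot = Bot"
| "subst f (Var a) = f a"
| "subst f (Neg \<phi>) = Neg (subst f \<phi>)"
| "subst f (And \<phi> \<psi>) = And (subst f \<phi>) (subst f \<psi>)"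
| "subst f (Or \<phi> \<psi>) = Or (subst f \<phi>) (subst f \<psi>)"
| "subst f (Before \<phi>) = Before (subst f \<phi>)"
| "subst f (Since \<phi> \<psi>) = Since (subst f \<phi>) (subst f \<psi>)"

lemma ltl_vars_subst: "ltl_vars (subst f \<alpha>) = (\<Union>a\<in>ltl_vars \<alpha>. ltl_vars (f a))"
  by (induction \<alpha>) auto

lemma ltl_size_subst:
  assumes "\<And>a. a \<in> ltl_vars \<alpha> \<Longrightarrow> ltl_size (f a) \<le> M" "M \<ge> 1"
  shows "ltl_size (subst f \<alpha>) \<le> ltl_size \<alpha> * M"
  using assms by (induction \<alpha>) (auto simp: algebra_simps intro: add_mono le_trans)

text \<open>A propositional formula never leaves the time \<open>t\<close>, so agreement at that
  single time is enough. This lets formulas that are correct only at positive times be substituted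
  into a rule body.\<close>

lemma holds_subst:
  assumes "propositional \<alpha>" "\<And>a. a \<in> ltl_vars \<alpha> \<Longrightarrow> holds V t (f a) \<longleftrightarrow> W t a"
  shows "holds V t (subst f \<alpha>) \<longleftrightarrow> holds W t \<alpha>"
  using assms by (induction \<alpha>) auto

lemma ltl_size_pos: "1 \<le> ltl_size \<phi>"
  by (cases \<phi>) auto

section \<open>Since and the automaton \<open>op_S\<close>\<close>

text \<open>The witness is either \<open>t\<close> itself or earlier, and in the latter case \<phi>
  must also hold at \<open>t\<close>. Positivity matters: a \<open>t\<close> below 1 is outside the
  range of witnesses.\<close>

lemma holds_Since_step:
  assumes "t > 0"
  shows "holds V t (Since \<phi> \<psi>) \<longleftrightarrow>
    holds V t \<psi> \<or> holds V t \<phi> \<and> holds V (t - 1) (Since \<phi> \<psi>)"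
proof -
  have "{1..t} = insert t {1..t - 1}" using assms by auto
  moreover have "{j + 1..t} = insert t {j + 1..t - 1}" if "j \<in> {1..t - 1}" for j
    using that by auto
  ultimately show ?thesis by auto
qed

text \<open>This time test, put under \<open>Before\<close>, tells time 1 from later times.\<close>

lemma holds_Since_Top: "holds V t (Since Top Top) \<longleftrightarrow> t > 0"
  by auto

lemma valuation_op_S:
  assumes V: "is_valuation P I V" and r: "Dynamic ps op_S as \<in> P"
  shows "V t (ps ! 0) \<longleftrightarrow> t = 0 \<or> t > 0 \<and> \<not> V t (as ! 1) \<and>
      (V (t - 1) (ps ! 0) \<or> V (t - 1) (ps ! 1) \<and> \<not> V t (as ! 0))"
    and "V t (ps ! 1) \<longleftrightarrow> t > 0 \<and>
      (V (t - 1) (ps ! 0) \<and> V t (as ! 1) \<or>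
       V (t - 1) (ps ! 1) \<and> (V t (as ! 0) \<or> V t (as ! 1)))"
proof -
  have step: "V t (ps ! (i - 1)) \<longleftrightarrow> t = 0 \<and> 1 = i \<or>
      t > 0 \<and> (\<exists>j\<in>{1..2}. delta_S j [V t (as ! 0), V t (as ! 1)] = i \<and> V (t - 1) (ps ! (j - 1)))"
    if i: "i \<in> {1..2}" for i
  proof -
    \<comment> \<open>The values of the two arguments force the input word, so the quantifier over
      \<open>\<sigma>\<close> collapses.\<close>
    have ex: "(\<exists>\<sigma>. length \<sigma> = 2 \<and> delta_S j \<sigma> = i \<and> X \<and> (\<forall>k<2. V t (as ! k) \<longleftrightarrow> \<sigma> ! k)) \<longleftrightarrow>
        delta_S j [V t (as ! 0), V t (as ! 1)] = i \<and> X" for j X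
    proof -
      have "length \<sigma> = 2 \<and> (\<forall>k<2. V t (as ! k) \<longleftrightarrow> \<sigma> ! k) \<longleftrightarrow>
          \<sigma> = [V t (as ! 0), V t (as ! 1)]" for \<sigma> :: "bool list"
        by (auto simp: length_Suc_conv numeral_2_eq_2 less_Suc_eq)
      then show ?thesis by metis
    qed
    have "V t (ps ! (i - 1)) \<longleftrightarrow> t = 0 \<and> 1 = i \<or>
        t > 0 \<and> (\<exists>j\<in>{1..2}. \<exists>\<sigma>. length \<sigma> = 2 \<and> delta_S j \<sigma> = i \<and>
          V (t - 1) (ps ! (j - 1)) \<and> (\<forall>k<2. V t (as ! k) \<longleftrightarrow> \<sigma> ! k))"
      using V[unfolded is_valuation_def, THEN conjunct2, THEN conjunct2, THEN conjunct2,
          rule_format, of ps op_S as i t] r i unfolding op_S_def automaton.sel by blast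
    then show ?thesis unfolding ex .
  qed
  have states: "{1..2} = {1, 2::nat}" by auto
  show "V t (ps ! 0) \<longleftrightarrow> t = 0 \<or> t > 0 \<and> \<not> V t (as ! 1) \<and>
      (V (t - 1) (ps ! 0) \<or> V (t - 1) (ps ! 1) \<and> \<not> V t (as ! 0))"
    using step[of 1] unfolding states by (auto simp: delta_S_def)
  show "V t (ps ! 1) \<longleftrightarrow> t > 0 \<and>
      (V (t - 1) (ps ! 0) \<and> V t (as ! 1) \<or>
       V (t - 1) (ps ! 1) \<and> (V t (as ! 0) \<or> V t (as ! 1)))"
    using step[of 2] unfolding states by (auto simp: delta_S_def)
qed

text \<open>State 2 records that since holds. Both heads share one induction because each transition
  reads both previous states. It starts at time 0, where the state is 1 and since has no witness;
  every later step reads the arguments at positive times only, where \<phi> and \<psi> are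
  correct.\<close>

lemma valuation_op_S_Since:
  assumes V: "is_valuation P I V" and r: "Dynamic ps op_S as \<in> P"
    and \<phi>: "\<And>s. s \<ge> 1 \<Longrightarrow> holds V s \<phi> \<longleftrightarrow> V s (as ! 0)"
    and \<psi>: "\<And>s. s \<ge> 1 \<Longrightarrow> holds V s \<psi> \<longleftrightarrow> V s (as ! 1)"
    and t: "t \<ge> 0"
  shows "(V t (ps ! 0) \<longleftrightarrow> \<not> holds V t (Since \<phi> \<psi>)) \<and> (V t (ps ! 1) \<longleftrightarrow> holds V t (Since \<phi> \<psi>))"
  using t
proof (induction t rule: int_ge_induct)
  case base
  show ?case using valuation_op_S[OF V r, of 0] by simp
next
  case (step t)
  \<comment> \<open>Since stays folded, so that its expansion at \<open>t + 1\<close> meets the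
    induction hypothesis at \<open>t\<close>.\<close>
  then show ?case
    using valuation_op_S[OF V r, of "t + 1"] \<phi>[of "t + 1"] \<psi>[of "t + 1"]
      holds_Since_step[of "t + 1" V \<phi> \<psi>]
    by (simp del: holds.simps) blast
qed

section \<open>The exponent of the size bound\<close>

text \<open>Comparing ranks overapproximates the set of rules that \<open>a\<close> depends on. A
  rule reached through several body variables is counted once.\<close>

definition cone_size :: "'v rule set \<Rightarrow> 'v \<Rightarrow> nat" where
  "cone_size P a = sum rule_size {r \<in> P. \<exists>h\<in>head_vars r. var_rank P h \<le> var_rank P a}"

lemma cone_size_le:
  assumes "program P"
  shows "cone_size P a \<le> program_size P"
  unfolding cone_size_def program_size_def
  using assms by (intro sum_mono2) (auto simp: program_def)

text \<open>All heads of \<open>r\<close> outrank \<open>b\<close>, so \<open>r\<close> counts for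
  \<open>a\<close> but not for \<open>b\<close>, while every rule counted for \<open>b\<close> is
  also counted for \<open>a\<close>.\<close>

lemma cone_size_body:
  assumes P: "program P" and r: "r \<in> P" "b \<in> body_vars r" "a \<in> head_vars r"
  shows "cone_size P b + rule_size r \<le> cone_size P a"
proof -
  let ?R = "\<lambda>c. {r \<in> P. \<exists>h\<in>head_vars r. var_rank P h \<le> var_rank P c}"
  have fin: "finite (?R c)" for c using P by (simp add: program_def)
  have "r \<notin> ?R b"
    using var_rank_less[OF P r(1,2)] by fastforce
  then have "cone_size P b + rule_size r = sum rule_size (insert r (?R b))"
    using fin unfolding cone_size_def by simp
  also have "\<dots> \<le> cone_size P a"
    unfolding cone_size_def
  proof (intro sum_mono2 fin)
    have "?R b \<subseteq> ?R a"
      using var_rank_less[OF P r] by (auto intro: le_trans less_imp_le)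
    then show "insert r (?R b) \<subseteq> ?R a"
      using r by blast
  qed simp
  finally show ?thesis .
qed

section \<open>Expressibility of variables, by kind of rule\<close>

definition expresses :: "'v rule set \<Rightarrow> 'v \<Rightarrow> 'v ltl \<Rightarrow> bool" where
  "expresses P a \<phi> \<longleftrightarrow> ltl_vars \<phi> \<subseteq> input_vars P \<and>
     (\<forall>I V t. is_valuation P I V \<and> t \<ge> 1 \<longrightarrow> (V t a \<longleftrightarrow> holds V t \<phi>))"

text \<open>Negative times are included because chains of delay rules reach them from time
  1.\<close>

definition rigid_before :: "'v rule set \<Rightarrow> 'v \<Rightarrow> bool" where
  "rigid_before P a \<longleftrightarrow>
     (\<forall>I I' V V' t. is_valuation P I V \<and> is_valuation P I' V' \<and> t \<le> 0 \<longrightarrow> V t a = V' t a)"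

lemma expressible_input:
  assumes "a \<in> input_vars P"
  shows "expresses P a (Var a)" "rigid_before P a"
  using assms unfolding expresses_def rigid_before_def is_valuation_def input_vars_def in_interp_def
  by auto

text \<open>Head and body are read at the same time, so both properties pass through the
  propositional body.\<close>

lemma expressible_static:
  assumes P: "program P" and r: "Static p \<alpha> \<in> P"
    and f: "\<And>b. b \<in> ltl_vars \<alpha> \<Longrightarrow> expresses P b (f b)"
    and c: "\<And>b. b \<in> ltl_vars \<alpha> \<Longrightarrow> rigid_before P b"
  shows "expresses P p (subst f \<alpha>)"
    and "rigid_before P p"
proof -
  have static: "propositional \<alpha>" using P r unfolding program_def by fastforce
  have V: "V t p \<longleftrightarrow> holds V t \<alpha>" if "is_valuation P I V" for I V t
    using that r unfolding is_valuation_def by blast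
  show "expresses P p (subst f \<alpha>)"
    unfolding expresses_def ltl_vars_subst
  proof (intro conjI allI impI, goal_cases)
    case 1
    then show ?case using f unfolding expresses_def by blast
  next
    case (2 I W t)
    then have "holds W t (subst f \<alpha>) \<longleftrightarrow> holds W t \<alpha>"
      using f unfolding expresses_def by (intro holds_subst[OF static]) blast
    then show ?case using V[of I W] 2 by blast
  qed
  show "rigid_before P p"
    unfolding rigid_before_def
  proof (intro allI impI, elim conjE)
    fix I I' V V' and t :: int
    assume *: "is_valuation P I V" "is_valuation P I' V'" "t \<le> 0"
    then show "V t p = V' t p"
      using V holds_propositional_cong[OF static, of V t V'] c unfolding rigid_before_def by blast
  qed
qed

text \<open>\<open>Before \<phi>\<close> alone may go wrong at time 1, where it reads \<phi> at time
  0. By rigidity of \<open>q\<close> the value of \<open>p\<close> at time 1 is a constant, which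
  the time test substitutes there.\<close>

lemma expressible_delay:
  assumes P: "program P" and r: "Delay p q \<in> P"
    and \<phi>: "expresses P q \<phi>" and c: "rigid_before P q"
  shows "\<exists>\<psi>. expresses P p \<psi> \<and> ltl_size \<psi> \<le> ltl_size \<phi> + 7" "rigid_before P p"
proof -
  have V: "V t p \<longleftrightarrow> V (t - 1) q" if "is_valuation P I V" for I V t
    using that r unfolding is_valuation_def by simp
  \<comment> \<open>By rigidity, any one valuation reveals the value of \<open>q\<close> at time
    0.\<close>
  obtain I0 V0 where V0: "is_valuation P I0 V0"
    using ex1_valuation[OF P] by blast
  have zero: "W 0 q \<longleftrightarrow> V0 0 q" if "is_valuation P I W" for I W
    using c that V0 unfolding rigid_before_def by blast
  \<comment> \<open>The added disjunct is true at time 1 only and the added conjunct is false at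
    time 1, so each forces the constant there and is neutral at later times.\<close>
  define \<psi> where "\<psi> = (if V0 0 q then Or (Before \<phi>) (Neg (Before (Since Top Top)))
    else And (Before \<phi>) (Before (Since Top Top)))"
  have "W t p \<longleftrightarrow> holds W t \<psi>" if W: "is_valuation P I W" and t: "t \<ge> 1" for I W t
  proof (cases "t = 1")
    case True
    then show ?thesis using V[OF W, of 1] zero[OF W] by (simp add: \<psi>_def)
  next
    case False
    then show ?thesis
      using V[OF W, of t] t \<phi> W holds_Since_Top[of W "t - 1"]
      unfolding expresses_def \<psi>_def by (simp del: holds.simps(8))
  qed
  moreover have "ltl_vars \<psi> \<subseteq> input_vars P"
    using \<phi> by (simp add: expresses_def \<psi>_def)
  ultimately have "expresses P p \<psi>"
    unfolding expresses_def by blast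
  moreover have "ltl_size \<psi> \<le> ltl_size \<phi> + 7" by (simp add: \<psi>_def)
  ultimately show "\<exists>\<psi>. expresses P p \<psi> \<and> ltl_size \<psi> \<le> ltl_size \<phi> + 7" by blast
  show "rigid_before P p"
    unfolding rigid_before_def
  proof (intro allI impI, elim conjE)
    fix I I' W W' and t :: int
    assume *: "is_valuation P I W" "is_valuation P I' W'" "t \<le> 0"
    then have "W (t - 1) q = W' (t - 1) q"
      using c[unfolded rigid_before_def, rule_format, of I W I' W' "t - 1"] by simp
    then show "W t p = W' t p" using V[OF *(1)] V[OF *(2)] by simp
  qed
qed

lemma expressible_dynamic:
  assumes r: "Dynamic ps op_S as \<in> P"
    and \<phi>: "expresses P (as ! 0) \<phi>" and \<psi>: "expresses P (as ! 1) \<psi>"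
  shows "expresses P (ps ! 0) (Neg (Since \<phi> \<psi>))" "expresses P (ps ! 1) (Since \<phi> \<psi>)"
    "rigid_before P (ps ! 0)" "rigid_before P (ps ! 1)"
proof -
  have sem: "(V t (ps ! 0) \<longleftrightarrow> \<not> holds V t (Since \<phi> \<psi>)) \<and> (V t (ps ! 1) \<longleftrightarrow> holds V t (Since \<phi> \<psi>))"
    if "is_valuation P I V" "t \<ge> 1" for I V t
    using valuation_op_S_Since[OF that(1) r, of \<phi> \<psi> t] that \<phi> \<psi>
    unfolding expresses_def by auto
  have vars: "ltl_vars (Since \<phi> \<psi>) \<subseteq> input_vars P"
    using \<phi> \<psi> by (simp add: expresses_def)
  show "expresses P (ps ! 0) (Neg (Since \<phi> \<psi>))" "expresses P (ps ! 1) (Since \<phi> \<psi>)"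
    unfolding expresses_def ltl.set(4) holds.simps(4)
    by (intro conjI allI impI vars; elim conjE; drule (1) sem; elim conjE; assumption)+
  \<comment> \<open>The automaton is in state 1 at time 0 and in no state before, whatever the
    interpretation.\<close>
  have "V t (ps ! 0) \<longleftrightarrow> t = 0" "\<not> V t (ps ! 1)" if "is_valuation P I V" "t \<le> 0" for I V t
    using valuation_op_S[OF that(1) r, of t] that(2) by auto
  then show "rigid_before P (ps ! 0)" "rigid_before P (ps ! 1)"
    unfolding rigid_before_def by metis+
qed

section \<open>Induction along the dependency order\<close>

text \<open>Rigidity is carried through the induction because a delay rule requires it of its body
  variable.\<close>

lemma expressible:
  assumes P: "P \<in> lang_S" and a: "a \<in> program_vars P"
  shows "(\<exists>\<phi>. expresses P a \<phi> \<and> ltl_size \<phi> \<le> 2 ^ cone_size P a) \<and> rigid_before P a"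
  using a
proof (induction "var_rank P a" arbitrary: a rule: less_induct)
  case less
  have prog: "program P" using P by (simp add: lang_S_def)
  show ?case
  proof (cases "a \<in> defined_vars P")
    case False
    then have a: "a \<in> input_vars P" using less.prems by (simp add: input_vars_def)
    have "expresses P a (Var a) \<and> ltl_size (Var a) \<le> 2 ^ cone_size P a" "rigid_before P a"
      using expressible_input[OF a] by simp_all
    then show ?thesis by blast
  next
    case True
    then obtain r where r: "r \<in> P" "a \<in> head_vars r" unfolding defined_vars_def by blast
    have "b \<in> program_vars P" if "b \<in> body_vars r" for b
      using that r(1) unfolding program_vars_def by blast
    then have "\<exists>\<phi>. expresses P b \<phi> \<and> ltl_size \<phi> \<le> 2 ^ cone_size P b" and c: "rigid_before P b"
      if "b \<in> body_vars r" for b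
      using less.hyps[OF var_rank_less[OF prog r(1) that r(2)]] that by blast+
    then obtain f where f: "\<And>b. b \<in> body_vars r \<Longrightarrow> expresses P b (f b)"
      "\<And>b. b \<in> body_vars r \<Longrightarrow> ltl_size (f b) \<le> 2 ^ cone_size P b" by metis
    \<comment> \<open>A common bound for the formulas of all body variables, leaving a factor of 2
      to the power \<open>rule_size r\<close>. The subtraction is exact, since \<open>r\<close>
      itself counts for \<open>a\<close>.\<close>
    define M :: nat where "M = 2 ^ (cone_size P a - rule_size r)"
    have M1: "M \<ge> 1" unfolding M_def by simp
    have M: "ltl_size (f b) \<le> M" if "b \<in> body_vars r" for b
    proof -
      have "cone_size P b \<le> cone_size P a - rule_size r"
        using cone_size_body[OF prog r(1) that r(2)] by simp
      then have "(2::nat) ^ cone_size P b \<le> M"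
        unfolding M_def by (intro power_increasing) auto
      then show ?thesis using f(2)[OF that] by linarith
    qed
    have rs: "rule_size r \<le> cone_size P a"
      unfolding cone_size_def using r prog
      by (intro member_le_sum) (auto simp: program_def)
    then have N: "2 ^ rule_size r * M = 2 ^ cone_size P a"
      unfolding M_def by (simp flip: power_add)
    show ?thesis
    proof (cases r)
      case (Static p \<alpha>)
      then have p: "a = p" using r by simp
      have "ltl_size (subst f \<alpha>) \<le> ltl_size \<alpha> * M"
        using M M1 Static by (intro ltl_size_subst) auto
      \<comment> \<open>Here \<open>n < 2 ^ n\<close> is used for \<open>n = rule_size r\<close>,
        which exceeds the size of \<alpha> by 1.\<close>
      also have "\<dots> \<le> 2 ^ rule_size r * M"
        using less_exp[of "rule_size r"] by (intro mult_right_mono) (auto simp: Static)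
      finally have "ltl_size (subst f \<alpha>) \<le> 2 ^ cone_size P a" using N by simp
      then show ?thesis
        using expressible_static[OF prog, of p \<alpha> f] r f(1) c p Static by auto
    next
      case (Delay p q)
      then have p: "a = p" and rq: "Delay p q \<in> P" and q: "q \<in> body_vars r" using r by auto
      obtain \<psi> where \<psi>: "expresses P p \<psi>" "ltl_size \<psi> \<le> ltl_size (f q) + 7"
        using expressible_delay(1)[OF prog rq f(1)[OF q] c[OF q]] by blast
      \<comment> \<open>The rule has size 3, and \<open>M + 7 <= 8 * M\<close> because
        \<open>M >= 1\<close>.\<close>
      have "ltl_size \<psi> \<le> 2 ^ rule_size r * M"
        using \<psi>(2) M[OF q] M1 Delay by simp
      then show ?thesis
        using \<psi>(1) N expressible_delay(2)[OF prog rq f(1)[OF q] c[OF q]] p by auto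
    next
      case (Dynamic ps A as)
      then have A: "A = op_S" and rS: "Dynamic ps op_S as \<in> P"
        using P r(1) unfolding lang_S_def by auto
      have len: "length ps = 2" "length as = 2"
        using program_Dynamic[OF prog rS] by (simp_all add: op_S_def)
      then have b: "as ! 0 \<in> body_vars r" "as ! 1 \<in> body_vars r" using Dynamic by simp_all
      note e = expressible_dynamic[OF rS f(1)[OF b(1)] f(1)[OF b(2)]]
      let ?S = "Since (f (as ! 0)) (f (as ! 1))"
      \<comment> \<open>The rule has size 5, and \<open>2 * M + 2 <= 32 * M\<close>.\<close>
      have "ltl_size (Neg ?S) \<le> 2 ^ rule_size r * M"
        using M[OF b(1)] M[OF b(2)] M1 Dynamic len by simp
      then have size: "ltl_size (Neg ?S) \<le> 2 ^ cone_size P a" "ltl_size ?S \<le> 2 ^ cone_size P a"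
        using N by simp_all
      have "a \<in> set ps" using r(2) Dynamic by simp
      then have "a = ps ! 0 \<or> a = ps ! 1"
        using len by (auto simp: in_set_conv_nth less_2_cases_iff)
      then show ?thesis using e size by blast
    qed
  qed
qed

theorem theorem12:
  shows "\<exists>c::nat. \<forall>(P :: 'v rule set) (a :: 'v). P \<in> lang_S \<and> a \<in> program_vars P \<longrightarrow>
    (\<exists>\<phi> :: 'v ltl. ltl_vars \<phi> \<subseteq> input_vars P \<and>
       ltl_size \<phi> \<le> 2 ^ (c * program_size P) \<and>
       (\<forall>(I :: 'v set list) (t :: int). interpretation_of P I \<and> t \<in> {1..int (length I)} \<longrightarrow>
          (sat P I t (Var a) \<longleftrightarrow> sat P I t \<phi>)))"
proof (intro exI[of _ 1] allI impI, elim conjE)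
  fix P :: "'v rule set" and a :: 'v
  assume P: "P \<in> lang_S" and a: "a \<in> program_vars P"
  have prog: "program P" using P by (simp add: lang_S_def)
  obtain \<phi> where \<phi>: "expresses P a \<phi>" "ltl_size \<phi> \<le> 2 ^ cone_size P a"
    using expressible[OF P a] by blast
  \<comment> \<open>The constant \<open>c\<close> can be 1: the rules counted for \<open>a\<close>
    are among those of \<open>P\<close>.\<close>
  have "(2::nat) ^ cone_size P a \<le> 2 ^ (1 * program_size P)"
    using cone_size_le[OF prog, of a] by (intro power_increasing) auto
  with \<phi>(2) have "ltl_size \<phi> \<le> 2 ^ (1 * program_size P)" by linarith
  moreover have "sat P I t (Var a) \<longleftrightarrow> sat P I t \<phi>" if "t \<in> {1..int (length I)}" for I t
    using \<phi>(1) is_valuation_the[OF prog, of I] that unfolding expresses_def sat_def by simp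
  ultimately show "\<exists>\<phi>. ltl_vars \<phi> \<subseteq> input_vars P \<and> ltl_size \<phi> \<le> 2 ^ (1 * program_size P) \<and>
      (\<forall>I t. interpretation_of P I \<and> t \<in> {1..int (length I)} \<longrightarrow>
        (sat P I t (Var a) \<longleftrightarrow> sat P I t \<phi>))"
    using \<phi>(1) unfolding expresses_def by blast
qed

end
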